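(* Let $p$ be an odd prime. Let $\mathcal{P}=(\mu_1,\mu_2,\dots,\mu_m)$ be an $m$-tuple of positive integers, let $(\omega_1,\omega_2,\dots,\omega_m)$ be an $m$-tuple of non-zero residue classes mod $p$, and let $\alpha$ be an arbitrary residue class mod $p$. Let $n_{\mathcal{P},\alpha}$ be the number of $(\mu_1+\dots+\mu_m)$-tuples of integers $$(r_1,\dots,r_{\mu_1},\,s_1,\dots,s_{\mu_2},\,\dots,\,z_1,\dots,z_{\mu_m})$$ (consisting of $m$ consecutive blocks, the $i$-th block having $\mu_i$ entries) which satisfy $$\omega_1(r_1+\dots+r_{\mu_1})+\omega_2(s_1+\dots+s_{\mu_2})+\dots+\omega_m(z_1+\dots+z_{\mu_m})\equiv\alpha \pmod p$$ subject to $$p-1\ge r_1\ge\dots\ge r_{\mu_1}\ge 1,\quad p-1\ge s_1\ge\dots\ge s_{\mu_2}\ge 1,\quad\dots,\quad p-1\ge z_1\ge\dots\ge z_{\mu_m}\ge 1.$$ Let $$B_{\mathcal{P}}=\prod_{i=1}^m\binom{\mu_i+p-2}{\mu_i},$$ and let $t\ge 0$ be the number of indices $i$ such that $\mu_i\equiv 1 \pmod p$. Then $$(n_{\mathcal{P},0},\,n_{\mathcal{P},1},\,\dots,\,n_{\mathcal{P},p-1})=(W_{\mathcal{P}},Z_{\mathcal{P}},\dots,Z_{\mathcal{P}}),$$ where $$W_{\mathcal{P}}=\begin{cases}B_{\mathcal{P}}/p & \text{if there exists } i \text{ with } \mu_i\not\equiv 0,1 \pmod p,\\[2pt] \dfrac{B_{\mathcal{P}}+(-1)^{t+1}}{p}+(-1)^t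 & \text{otherwise,}\end{cases}$$ $$Z_{\mathcal{P}}=\begin{cases}B_{\mathcal{P}}/p & \text{if there exists } i \text{ with } \mu_i\not\equiv 0,1 \pmod p,\\[2pt] \dfrac{B_{\mathcal{P}}+(-1)^{t+1}}{p} & \text{otherwise.}\end{cases}$$
   Context: The condition $\mu_i\not\equiv 0,1\pmod p$ means $\mu_i\not\equiv 0$ and $\mu_i\not\equiv 1$ modulo $p$. Equivalently, $n_{\mathcal{P},\alpha}$ counts $m$-tuples of multisets, the $i$-th being a multiset of size $\mu_i$ with elements in $\{1,\dots,p-1\}$, whose weighted total sum (with weight $\omega_i$ on the $i$-th multiset) is $\equiv\alpha$ mod $p$. *)

theory Defs
  imports Complex_Main "HOL-Number_Theory.Number_Theory"
begin

(* The tuples mu and omega are lists with entries mu ! i and omega ! i for i < length mu = m.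
   Residue classes mod p are given by integer representatives.
   A tuple (r_1, ..., s_1, ..., z_1, ...) is the list of its m consecutive blocks. *)

definition block_tuples :: "nat \<Rightarrow> nat list \<Rightarrow> int list list set" where
  "block_tuples p mu = {rs. length rs = length mu \<and>
     (\<forall>i<length mu. length (rs ! i) = mu ! i \<and> sorted_wrt (\<ge>) (rs ! i) \<and>
        (\<forall>r\<in>set (rs ! i). 1 \<le> r \<and> r \<le> int p - 1))}"

definition num_solutions :: "nat \<Rightarrow> nat list \<Rightarrow> int list \<Rightarrow> int \<Rightarrow> nat" where
  "num_solutions p mu omega \<alpha> = card {rs \<in> block_tuples p mu.
     [(\<Sum>i<length mu. omega ! i * sum_list (rs ! i)) = \<alpha>] (mod int p)}"

definition B_coeff :: "nat \<Rightarrow> nat list \<Rightarrow> nat" where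
  "B_coeff p mu = (\<Prod>i<length mu. (mu ! i + p - 2) choose (mu ! i))"

definition t_count :: "nat \<Rightarrow> nat list \<Rightarrow> nat" where
  "t_count p mu = card {i. i < length mu \<and> [mu ! i = 1] (mod p)}"

definition has_generic_part :: "nat \<Rightarrow> nat list \<Rightarrow> bool" where
  "has_generic_part p mu \<longleftrightarrow>
     (\<exists>i<length mu. \<not> [mu ! i = 0] (mod p) \<and> \<not> [mu ! i = 1] (mod p))"

definition W_value :: "nat \<Rightarrow> nat list \<Rightarrow> real" where
  "W_value p mu =
     (if has_generic_part p mu then real (B_coeff p mu) / real p
      else (real (B_coeff p mu) + (-1) ^ (t_count p mu + 1)) / real p + (-1) ^ t_count p mu)"

definition Z_value :: "nat \<Rightarrow> nat list \<Rightarrow> real" where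
  "Z_value p mu =
     (if has_generic_part p mu then real (B_coeff p mu) / real p
      else (real (B_coeff p mu) + (-1) ^ (t_count p mu + 1)) / real p)"

end

theory Submission
  imports Defs "HOL-Computational_Algebra.Polynomial_FPS"
begin

text \<open>
  By Fourier inversion over the residue classes, p times the number of solutions is a sum over the
  p characters; each summand factors over the blocks. The factor of a block of size n is the
  complete homogeneous symmetric polynomial of degree n evaluated at the character values at
  1, ..., p - 1. For the trivial character this is a binomial coefficient. For every other character
  these values are the p-th roots of unity except 1, so the generating function is
  (1 - X) / (1 - X ^ p), whose coefficients are 1, -1 or 0 according to n mod p.
\<close>

subsection \<open>Complete homogeneous sums over decreasing lists\<close>

text \<open>A single block for modulus \<open>k + 1\<close>. The bound \<open>k\<close> is a free
  parameter so that one can induct on the number of admissible values.\<close>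

definition decr_lists :: "nat \<Rightarrow> nat \<Rightarrow> int list set" where
  "decr_lists k n = {xs. length xs = n \<and> sorted_wrt (\<ge>) xs \<and> (\<forall>x\<in>set xs. 1 \<le> x \<and> x \<le> int k)}"

lemma decr_lists_0_right: "decr_lists k 0 = {[]}"
  by (auto simp: decr_lists_def)

lemma decr_lists_0_left: "decr_lists 0 (Suc n) = {}"
proof -
  have "xs \<notin> decr_lists 0 (Suc n)" for xs
    by (cases xs) (auto simp: decr_lists_def)
  then show ?thesis by blast
qed

text \<open>The head is the largest entry, so it decides whether \<open>Suc k\<close> occurs at all.
  If it does, the tail may repeat it, hence the unchanged bound in the second part.\<close>

lemma decr_lists_Suc_Suc:
  "decr_lists (Suc k) (Suc n) =
     decr_lists k (Suc n) \<union> (\<lambda>xs. int (Suc k) # xs) ` decr_lists (Suc k) n" (is "?L = ?R")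
proof
  show "?L \<subseteq> ?R"
  proof
    fix xs assume xs: "xs \<in> ?L"
    then obtain y ys where ys: "xs = y # ys"
      by (cases xs) (auto simp: decr_lists_def)
    show "xs \<in> ?R"
    proof (cases "y = int (Suc k)")
      case True
      with xs ys show ?thesis by (auto simp: decr_lists_def)
    next
      case False
      with xs ys have "y \<le> int k" by (auto simp: decr_lists_def)
      with xs ys have "xs \<in> decr_lists k (Suc n)" by (fastforce simp: decr_lists_def)
      then show ?thesis by blast
    qed
  qed
  show "?R \<subseteq> ?L" by (fastforce simp: decr_lists_def)
qed

lemma finite_decr_lists: "finite (decr_lists k n)"
proof (rule finite_subset)
  show "decr_lists k n \<subseteq> {xs. set xs \<subseteq> {1..int k} \<and> length xs = n}"
    by (auto simp: decr_lists_def)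
  show "finite {xs. set xs \<subseteq> {1..int k} \<and> length xs = n}"
    by (rule finite_lists_length_eq) simp
qed

text \<open>The complete homogeneous symmetric polynomial h_n at the arguments f(1), ...,
  f(k).\<close>

definition hom_sum :: "(int \<Rightarrow> 'a::comm_ring_1) \<Rightarrow> nat \<Rightarrow> nat \<Rightarrow> 'a" where
  "hom_sum f k n = (\<Sum>xs\<in>decr_lists k n. prod_list (map f xs))"

lemma hom_sum_0_right: "hom_sum f k 0 = 1"
  by (simp add: hom_sum_def decr_lists_0_right)

lemma hom_sum_0_left: "hom_sum f 0 (Suc n) = 0"
  by (simp add: hom_sum_def decr_lists_0_left)

lemma hom_sum_Suc_Suc:
  "hom_sum f (Suc k) (Suc n) = hom_sum f k (Suc n) + f (int (Suc k)) * hom_sum f (Suc k) n"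
proof -
  let ?g = "\<lambda>xs. int (Suc k) # xs"
  have disj: "decr_lists k (Suc n) \<inter> ?g ` decr_lists (Suc k) n = {}"
    by (auto simp: decr_lists_def)
  have "(\<Sum>xs\<in>?g ` decr_lists (Suc k) n. prod_list (map f xs)) =
        f (int (Suc k)) * hom_sum f (Suc k) n"
    by (subst sum.reindex) (auto simp: inj_on_def hom_sum_def sum_distrib_left)
  then show ?thesis
    unfolding hom_sum_def decr_lists_Suc_Suc
    by (subst sum.union_disjoint) (use disj in \<open>simp_all add: finite_decr_lists hom_sum_def\<close>)
qed

text \<open>With all arguments 1 the recurrence becomes Pascal's rule. For \<open>k = 0\<close> the
  truncated subtraction still gives the right values: 1 at \<open>n = 0\<close>, and 0
  otherwise.\<close>

lemma hom_sum_1: "hom_sum (\<lambda>_. 1) k n = of_nat ((n + k - 1) choose n)"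
proof (induction k arbitrary: n)
  case 0
  show ?case by (cases n) (simp_all add: hom_sum_0_right hom_sum_0_left binomial_eq_0)
next
  case (Suc k)
  show ?case
  proof (induction n)
    case 0
    show ?case by (simp add: hom_sum_0_right)
  next
    case (Suc n)
    then show ?case by (simp add: hom_sum_Suc_Suc Suc.IH \<open>\<And>n. hom_sum (\<lambda>_. 1) k n = _\<close>)
  qed
qed

text \<open>The classical generating function of the h_n, stated as a product equal to 1 since the
  coefficients lie in a mere commutative ring. By the recurrence, multiplying by the factor of the
  last argument removes that argument.\<close>

lemma fps_hom_sum:
  "Abs_fps (hom_sum f k) * (\<Prod>r=1..k. 1 - fps_const (f (int r)) * fps_X) = 1"
proof (induction k)
  case 0
  have "hom_sum f 0 n = (if n = 0 then 1 else 0)" for n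
    by (cases n) (simp_all add: hom_sum_0_right hom_sum_0_left)
  then show ?case by (simp add: fps_eq_iff)
next
  case (Suc k)
  have "Abs_fps (hom_sum f (Suc k)) * (1 - fps_const (f (int (Suc k))) * fps_X) =
        Abs_fps (hom_sum f k)" (is "?H * ?Q = _")
  proof (rule fps_ext)
    fix n
    have "?H * ?Q = ?H - fps_const (f (int (Suc k))) * (fps_X * ?H)"
      by (simp add: algebra_simps)
    then show "fps_nth (?H * ?Q) n = fps_nth (Abs_fps (hom_sum f k)) n"
      by (cases n) (simp_all add: hom_sum_0_right hom_sum_Suc_Suc)
  qed
  moreover have "(\<Prod>r=1..Suc k. 1 - fps_const (f (int r)) * fps_X) =
      ?Q * (\<Prod>r=1..k. 1 - fps_const (f (int r)) * fps_X)"
    by (subst prod.nat_ivl_Suc') simp_all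
  ultimately show ?case
    using Suc.IH by (metis mult.assoc)
qed

subsection \<open>Additive characters modulo p\<close>

definition chi :: "nat \<Rightarrow> int \<Rightarrow> complex" where
  "chi p s = cis (2 * pi * real_of_int s / real p)"

lemma chi_0: "chi p 0 = 1"
  by (simp add: chi_def)

lemma chi_add: "chi p (s + t) = chi p s * chi p t"
  by (simp add: chi_def cis_mult add_divide_distrib distrib_left)

lemma chi_power: "chi p s ^ n = chi p (int n * s)"
  by (simp add: chi_def DeMoivre mult_ac)

lemma chi_sum: "chi p (\<Sum>i\<in>A. f i) = (\<Prod>i\<in>A. chi p (f i))"
  by (induction A rule: infinite_finite_induct) (simp_all add: chi_0 chi_add)

lemma chi_mult_sum_list: "chi p (c * sum_list xs) = prod_list (map (\<lambda>x. chi p (c * x)) xs)"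
  by (induction xs) (simp_all add: chi_0 chi_add distrib_left)

lemma chi_eq_1_iff:
  assumes "p > 0"
  shows "chi p s = 1 \<longleftrightarrow> int p dvd s"
proof
  assume "chi p s = 1"
  \<comment> \<open>The real part alone already forces the angle to be a multiple of 2 pi.\<close>
  then have "cos (2 * pi * real_of_int s / real p) = 1"
    by (simp add: chi_def complex_eq_iff)
  then obtain n :: int where "2 * pi * real_of_int s / real p = real_of_int n * 2 * pi"
    by (auto simp: cos_one_2pi_int)
  then have "real_of_int s = real_of_int (n * int p)"
    using assms by (simp add: field_simps)
  then have "s = n * int p" by (simp only: of_int_eq_iff)
  then show "int p dvd s" by simp
next
  assume "int p dvd s"
  then obtain n where "s = int p * n" by (auto elim: dvdE)
  then have "2 * pi * real_of_int s / real p = 2 * pi * real_of_int n"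
    using assms by simp
  then show "chi p s = 1"
    by (simp add: chi_def cis_multiple_2pi)
qed

lemma chi_eq_iff:
  assumes "p > 0"
  shows "chi p s = chi p t \<longleftrightarrow> int p dvd s - t"
proof -
  have "chi p s = chi p (s - t) * chi p t" by (simp flip: chi_add)
  moreover have "chi p t \<noteq> 0" by (simp add: chi_def)
  ultimately show ?thesis
    using chi_eq_1_iff[OF assms, of "s - t"] by auto
qed

text \<open>Orthogonality of characters: a geometric sum whose ratio is a p-th root of
  unity.\<close>

lemma sum_chi:
  assumes "p > 0"
  shows "(\<Sum>j<p. chi p (int j * s)) = (if int p dvd s then of_nat p else 0)"
proof (cases "int p dvd s")
  case True
  then have "chi p (int j * s) = 1" for j
    using chi_eq_1_iff[OF assms] by simp
  then show ?thesis using True by simp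
next
  case False
  then have "chi p s \<noteq> 1" using chi_eq_1_iff[OF assms] by simp
  moreover have "chi p s ^ p = 1" using chi_eq_1_iff[OF assms] by (simp add: chi_power)
  ultimately have "(\<Sum>j<p. chi p s ^ j) = 0" by (simp add: sum_gp_strict)
  then show ?thesis using False by (simp add: chi_power)
qed

text \<open>Both sides have degree at most \<open>p\<close> and agree at \<open>p + 1\<close>
  points: at 0, where both equal 1, and at the \<open>p\<close> roots of unity, where both
  vanish.\<close>

lemma poly_prod_chi:
  assumes "prime p" and "\<not> int p dvd c"
  shows "(\<Prod>r<p. [:1, - chi p (c * int r):]) = 1 - monom 1 p" (is "?P = ?Q")
proof (rule poly_eqI_degree)
  have p: "p > 0" using assms by (simp add: prime_gt_0_nat)
  \<comment> \<open>The minus sign is there because a factor 1 - zX vanishes at the inverse of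
    z.\<close>
  let ?A = "(\<lambda>r. chi p (- (c * int r))) ` {..<p}"
  have inj: "inj_on (\<lambda>r. chi p (- (c * int r))) {..<p}"
  proof (rule inj_onI)
    fix r s assume rs: "r \<in> {..<p}" "s \<in> {..<p}"
      and "chi p (- (c * int r)) = chi p (- (c * int s))"
    then have "int p dvd c * (int s - int r)"
      by (simp add: chi_eq_iff[OF p] algebra_simps)
    then have "int p dvd int s - int r"
      using assms by (simp add: prime_dvd_mult_iff)
    then show "r = s"
      using rs zdvd_not_zless[of "int s - int r" "int p"] zdvd_not_zless[of "int r - int s" "int p"]
      by (cases r s rule: linorder_cases) (auto simp: dvd_diff_commute)
  qed
  have "0 \<notin> ?A" by (auto simp: chi_def)
  with inj have card: "card (insert 0 ?A) = Suc p"
    by (simp add: card_image)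
  show "poly ?P x = poly ?Q x" if "x \<in> insert 0 ?A" for x
  proof (cases "x = 0")
    case True
    then show ?thesis using p by (simp add: poly_prod poly_monom)
  next
    case False
    with that obtain r where r: "r < p" "x = chi p (- (c * int r))" by auto
    have "poly [:1, - chi p (c * int r):] x = 0"
      using r by (simp add: chi_0 flip: chi_add)
    then have "poly ?P x = 0"
      using r by (auto simp: poly_prod intro!: prod_zero)
    moreover have "x ^ p = 1" using r p by (simp add: chi_power chi_eq_1_iff)
    ultimately show ?thesis by (simp add: poly_monom)
  qed
  have "degree ?P \<le> (\<Sum>r<p. degree [:1, - chi p (c * int r):])"
    using degree_prod_sum_le[of "{..<p}" "\<lambda>r. [:1, - chi p (c * int r):]"] by (simp add: o_def)
  also have "\<dots> \<le> (\<Sum>r<p. 1)" by (intro sum_mono) simp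
  finally show "degree ?P < card (insert 0 ?A)" using card by simp
  have "degree ?Q \<le> p" by (intro degree_diff_le) (simp_all add: degree_monom_le)
  then show "degree ?Q < card (insert 0 ?A)" using card by simp
qed

text \<open>For \<open>p > 1\<close> this is the coefficient of X^n in (1 - X) / (1 - X^p).\<close>

definition eps :: "nat \<Rightarrow> nat \<Rightarrow> int" where
  "eps p n = (if [n = 0] (mod p) then 1 else if [n = 1] (mod p) then -1 else 0)"

lemma hom_sum_chi:
  assumes "prime p" and "\<not> int p dvd c"
  shows "hom_sum (\<lambda>x. chi p (c * x)) (p - 1) n = of_int (eps p n)"
proof -
  define G where "G = Abs_fps (hom_sum (\<lambda>x. chi p (c * x)) (p - 1))"
  let ?q = "\<lambda>r. 1 - fps_const (chi p (c * int r)) * fps_X"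
  have p: "p > 1" using assms(1) by (rule prime_gt_1_nat)
  have "(\<Prod>r<p. ?q r) = fps_of_poly (\<Prod>r<p. [:1, - chi p (c * int r):])"
    by (simp add: fps_of_poly_prod fps_of_poly_pCons flip: fps_const_neg)
  also have "\<dots> = 1 - fps_X ^ p"
    by (simp add: poly_prod_chi[OF assms] fps_of_poly_diff fps_of_poly_monom)
  finally have *: "(\<Prod>r<p. ?q r) = 1 - fps_X ^ p" .
  \<comment> \<open>The generating function lacks the factor for \<open>r = 0\<close>, which is 1 -
    X; restoring it completes the product to 1 - X^p.\<close>
  have "{..<p} = insert 0 {1..p - 1}" using p by auto
  then have "(\<Prod>r<p. ?q r) = (1 - fps_X) * (\<Prod>r=1..p-1. ?q r)"
    by (simp add: chi_0)
  then have "G * (1 - fps_X ^ p) = (1 - fps_X) * (G * (\<Prod>r=1..p-1. ?q r))"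
    unfolding *[symmetric] by (simp add: ac_simps)
  also have "\<dots> = 1 - fps_X"
    unfolding G_def fps_hom_sum[of "\<lambda>x. chi p (c * x)"] by simp
  finally have G: "G = 1 - fps_X + fps_X ^ p * G"
    by (simp add: algebra_simps)
  \<comment> \<open>Reading off coefficients gives a recursion with stride \<open>p\<close>. The two
    initial terms matter only for \<open>n < p\<close>, because \<open>p > 1\<close>.\<close>
  have rec: "fps_nth G n = (if n = 0 then 1 else 0) - (if n = 1 then 1 else 0) +
                   (if n < p then 0 else fps_nth G (n - p))" for n
    by (subst G) (simp add: fps_X_power_mult_nth)
  have "fps_nth G n = of_int (eps p n)"
  proof (induction n rule: less_induct)
    case (less n)
    show ?case
    proof (cases "n < p")
      case True
      then show ?thesis using p by (subst rec) (auto simp: eps_def cong_def)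
    next
      case False
      then have "eps p (n - p) = eps p n" by (simp add: eps_def cong_def le_mod_geq)
      moreover have "fps_nth G (n - p) = of_int (eps p (n - p))"
        using False p by (intro less) simp
      ultimately show ?thesis using False p by (subst rec) auto
    qed
  qed
  then show ?thesis by (simp add: G_def)
qed

subsection \<open>Counting solutions\<close>

text \<open>A dependent finite product encoded by lists, to match the shape of
  \<open>block_tuples\<close> and allow induction by removing the head.\<close>

definition lists_in :: "nat \<Rightarrow> (nat \<Rightarrow> 'a set) \<Rightarrow> 'a list set" where
  "lists_in n A = {xs. length xs = n \<and> (\<forall>i<n. xs ! i \<in> A i)}"

lemma lists_in_0: "lists_in 0 A = {[]}"
  by (auto simp: lists_in_def)

lemma lists_in_Suc: "lists_in (Suc n) A = (\<lambda>(x, xs). x # xs) ` (A 0 \<times> lists_in n (\<lambda>i. A (Suc i)))"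
proof -
  have "xs \<in> lists_in (Suc n) A \<longleftrightarrow>
        xs \<in> (\<lambda>(x, xs). x # xs) ` (A 0 \<times> lists_in n (\<lambda>i. A (Suc i)))" for xs
    by (cases xs) (auto simp: lists_in_def All_less_Suc2 image_iff)
  then show ?thesis by blast
qed

lemma finite_lists_in: "(\<And>i. finite (A i)) \<Longrightarrow> finite (lists_in n A)"
  by (induction n arbitrary: A) (simp_all add: lists_in_0 lists_in_Suc)

text \<open>The general distributive law. Both \<open>A\<close> and \<open>f\<close> vary in the
  induction, as removing the head shifts all indices.\<close>

lemma sum_lists_in_prod:
  fixes f :: "nat \<Rightarrow> 'a \<Rightarrow> 'b::comm_semiring_1"
  shows "(\<Sum>xs\<in>lists_in n A. \<Prod>i<n. f i (xs ! i)) = (\<Prod>i<n. \<Sum>x\<in>A i. f i x)"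
proof (induction n arbitrary: A f)
  case 0
  show ?case by (simp add: lists_in_0)
next
  case (Suc n)
  let ?L = "lists_in n (\<lambda>i. A (Suc i))"
  have "inj_on (\<lambda>(x, xs). x # xs) (A 0 \<times> ?L)" by (auto simp: inj_on_def)
  then have "(\<Sum>xs\<in>lists_in (Suc n) A. \<Prod>i<Suc n. f i (xs ! i)) =
        (\<Sum>(x, xs)\<in>A 0 \<times> ?L. f 0 x * (\<Prod>i<n. f (Suc i) (xs ! i)))"
    unfolding lists_in_Suc
    by (subst sum.reindex) (auto simp: prod.lessThan_Suc_shift case_prod_unfold simp del: prod.lessThan_Suc)
  also have "\<dots> = (\<Sum>x\<in>A 0. f 0 x) * (\<Sum>xs\<in>?L. \<Prod>i<n. f (Suc i) (xs ! i))"
    by (simp add: sum_product sum.cartesian_product)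
  also have "\<dots> = (\<Prod>i<Suc n. \<Sum>x\<in>A i. f i x)"
    using Suc.IH[of "\<lambda>i. f (Suc i)" "\<lambda>i. A (Suc i)"]
    by (simp add: prod.lessThan_Suc_shift del: prod.lessThan_Suc)
  finally show ?case .
qed

lemma block_tuples_eq:
  assumes "p > 0"
  shows "block_tuples p mu = lists_in (length mu) (\<lambda>i. decr_lists (p - 1) (mu ! i))"
  using assms by (auto simp: block_tuples_def lists_in_def decr_lists_def of_nat_diff)

text \<open>The character turns the weighted sum into a product over blocks, and the distributive
  law then lets each block be summed separately.\<close>

lemma sum_block_tuples_chi:
  assumes "p > 0"
  shows "(\<Sum>rs\<in>block_tuples p mu. chi p (j * (\<Sum>i<length mu. omega ! i * sum_list (rs ! i)))) =
         (\<Prod>i<length mu. hom_sum (\<lambda>x. chi p (j * omega ! i * x)) (p - 1) (mu ! i))"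
proof -
  have "chi p (j * (\<Sum>i<length mu. omega ! i * sum_list (rs ! i))) =
        (\<Prod>i<length mu. prod_list (map (\<lambda>x. chi p (j * omega ! i * x)) (rs ! i)))" for rs
    by (simp add: sum_distrib_left chi_sum flip: mult.assoc chi_mult_sum_list)
  then show ?thesis
    using sum_lists_in_prod[where n = "length mu" and A = "\<lambda>i. decr_lists (p - 1) (mu ! i)"
        and f = "\<lambda>i xs. prod_list (map (\<lambda>x. chi p (j * omega ! i * x)) xs)"]
    by (simp add: block_tuples_eq[OF assms] hom_sum_def)
qed

text \<open>By orthogonality, \<open>p\<close> times the indicator of the congruence is a sum of
  characters; exchanging the two summations isolates each frequency \<open>j\<close>.\<close>

lemma num_solutions_fourier:
  assumes "p > 0"
  shows "of_nat p * of_nat (num_solutions p mu omega a) =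
         (\<Sum>j<p. chi p (- (int j * a)) *
            (\<Prod>i<length mu. hom_sum (\<lambda>x. chi p (int j * omega ! i * x)) (p - 1) (mu ! i)))"
proof -
  let ?S = "\<lambda>rs. \<Sum>i<length mu. omega ! i * sum_list (rs ! i)"
  have fin: "finite (block_tuples p mu)"
    by (simp add: block_tuples_eq[OF assms] finite_lists_in finite_decr_lists)
  have "(\<Sum>j<p. chi p (- (int j * a)) * (\<Sum>rs\<in>block_tuples p mu. chi p (int j * ?S rs))) =
        (\<Sum>rs\<in>block_tuples p mu. \<Sum>j<p. chi p (int j * (?S rs - a)))"
    by (subst sum.swap) (simp add: sum_distrib_left right_diff_distrib flip: chi_add)
  also have "\<dots> = (\<Sum>rs\<in>block_tuples p mu. if [?S rs = a] (mod int p) then of_nat p else 0)"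
    by (simp add: sum_chi[OF assms] cong_iff_dvd_diff)
  also have "\<dots> = of_nat p * of_nat (num_solutions p mu omega a)"
    unfolding num_solutions_def sum.inter_filter[OF fin, symmetric] by simp
  finally show ?thesis
    by (simp add: sum_block_tuples_chi[OF assms])
qed

lemma prod_eps:
  "(\<Prod>i<length mu. eps p (mu ! i)) =
     (if has_generic_part p mu then 0 else (-1) ^ t_count p mu)" if "p > 1"
proof (cases "has_generic_part p mu")
  case True
  then show ?thesis by (auto simp: has_generic_part_def eps_def)
next
  case False
  \<comment> \<open>Since \<open>eps\<close> tests the residue 0 first, the two cases must be seen
    to be disjoint before the sign can be read off from the residue 1 alone.\<close>
  have excl: "\<not> ([n = 0] (mod p) \<and> [n = 1] (mod p))" for n
    using that by (auto simp: cong_def)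
  have "eps p (mu ! i) = (if [mu ! i = 1] (mod p) then -1 else 1)" if "i < length mu" for i
    using False that excl by (auto simp: has_generic_part_def eps_def)
  then have "(\<Prod>i<length mu. eps p (mu ! i)) =
      (\<Prod>i<length mu. if [mu ! i = 1] (mod p) then -1 else 1)" by simp
  also have "\<dots> = (-1) ^ t_count p mu"
    by (simp add: prod.If_cases t_count_def Int_def lessThan_def)
  finally show ?thesis using False by simp
qed

text \<open>Frequency 0 yields the main term. At every other frequency the product over blocks has
  the same value \<open>E\<close>, so only a sum of characters over nonzero \<open>j\<close>
  remains.\<close>

lemma num_solutions_eq:
  assumes "prime p" and "length omega = length mu"
    and omega: "\<forall>i<length omega. \<not> [omega ! i = 0] (mod int p)"
  shows "real p * real (num_solutions p mu omega a) = real (B_coeff p mu) +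
         of_int (\<Prod>i<length mu. eps p (mu ! i)) * ((if int p dvd a then real p else 0) - 1)"
proof -
  have p: "p > 1" using assms(1) by (rule prime_gt_1_nat)
  define E where "E = (\<Prod>i<length mu. eps p (mu ! i))"
  let ?F = "\<lambda>j. \<Prod>i<length mu. hom_sum (\<lambda>x. chi p (int j * omega ! i * x)) (p - 1) (mu ! i)"
  have F0: "?F 0 = of_nat (B_coeff p mu)"
    using p by (simp add: chi_0 hom_sum_1 B_coeff_def diff_diff_add numeral_2_eq_2)
  have Fj: "?F j = of_int E" if j: "j \<in> {1..<p}" for j
  proof -
    \<comment> \<open>Primality keeps the product of two nonzero residues nonzero, so
      \<open>hom_sum_chi\<close> applies to every block.\<close>
    have "\<not> int p dvd int j * omega ! i" if "i < length mu" for i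
      using that omega j assms(1,2)
      by (auto simp: prime_dvd_mult_iff cong_0_iff dest: nat_dvd_not_less)
    then have "?F j = (\<Prod>i<length mu. of_int (eps p (mu ! i)))"
      by (intro prod.cong refl hom_sum_chi[OF assms(1)]) simp
    then show ?thesis by (simp add: E_def)
  qed
  have split: "{..<p} = insert 0 {1..<p}" using p by auto
  have "(\<Sum>j<p. chi p (- (int j * a))) = (if int p dvd a then of_nat p else 0)"
    using sum_chi[of p "- a"] p by simp
  \<comment> \<open>The subtracted 1 is the term of the full character sum at
    \<open>j = 0\<close>.\<close>
  then have rest: "(\<Sum>j\<in>{1..<p}. chi p (- (int j * a))) = (if int p dvd a then of_nat p else 0) - 1"
    by (simp add: split chi_0 eq_diff_eq add.commute)
  have "of_nat p * of_nat (num_solutions p mu omega a) =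
      ?F 0 + (\<Sum>j\<in>{1..<p}. chi p (- (int j * a)) * ?F j)"
    using p by (simp only: num_solutions_fourier split) (simp add: chi_0)
  also have "\<dots> = of_nat (B_coeff p mu) + (\<Sum>j\<in>{1..<p}. chi p (- (int j * a)) * of_int E)"
    unfolding F0 by (intro arg_cong2[where f = "(+)"] sum.cong refl) (simp only: Fj)
  also have "\<dots> = of_nat (B_coeff p mu) + of_int E * ((if int p dvd a then of_nat p else 0) - 1)"
    unfolding sum_distrib_right[symmetric] rest by (simp only: mult.commute)
  also have "\<dots> = complex_of_real (real (B_coeff p mu) +
      of_int E * ((if int p dvd a then real p else 0) - 1))"
    by simp
  finally have "complex_of_real (real p * real (num_solutions p mu omega a)) = \<dots>"
    by simp
  then show ?thesis unfolding E_def of_real_eq_iff .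
qed

theorem theorem1:
  fixes p :: nat and mu :: "nat list" and omega :: "int list"
  assumes "prime p" and "odd p"
    and "length omega = length mu"
    and "\<forall>i<length mu. mu ! i > 0"
    and "\<forall>i<length omega. \<not> [omega ! i = 0] (mod int p)"
  shows "map (\<lambda>a. real (num_solutions p mu omega (int a))) [0..<p] =
         W_value p mu # replicate (p - 1) (Z_value p mu)"
proof -
  have p: "p > 1" using assms(1) by (rule prime_gt_1_nat)
  have eq: "real (num_solutions p mu omega (int a)) = (real (B_coeff p mu) +
         of_int (\<Prod>i<length mu. eps p (mu ! i)) * ((if p dvd a then real p else 0) - 1)) / real p"
    for a
    using num_solutions_eq[OF assms(1,3,5), of "int a"] p
    by (simp add: eq_divide_eq mult.commute del: of_int_prod)
  \<comment> \<open>For \<open>a = 0\<close> the last factor is p - 1. With s = (-1)^t, the claimed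
    form is (B + s(p - 1))/p = (B - s)/p + s.\<close>
  have "real (num_solutions p mu omega (int 0)) = W_value p mu"
    unfolding eq prod_eps[OF p] W_value_def using p by (simp add: field_simps)
  \<comment> \<open>Here \<open>p\<close> does not divide \<open>a\<close>, so the last factor is -1
    and the value is independent of \<open>a\<close>.\<close>
  moreover have "real (num_solutions p mu omega (int a)) = Z_value p mu" if "0 < a" "a < p" for a
    unfolding eq prod_eps[OF p] Z_value_def using that by (auto dest: nat_dvd_not_less)
  ultimately show ?thesis
    using p by (intro nth_equalityI) (auto simp: nth_Cons simp del: of_nat_Suc split: nat.split)
qed

end
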